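(* For every $n\in\mathbb N$, $n\ge 1$, the inequality $ATV(\mu,\nu)\le\sqrt n\,\sqrt{2H(\mu|\nu)}$ (for Borel probability measures $\mu,\nu$ on a product $\mathcal X_1\times\dots\times\mathcal X_n$ of Polish spaces) is tight, i.e. its constant cannot be improved: for every real $c<\sqrt{n}$ there exist Polish spaces $\mathcal X_1,\dots,\mathcal X_n$ and Borel probability measures $\mu,\nu$ on $\mathcal X_1\times\dots\times\mathcal X_n$ with $0<H(\mu|\nu)<\infty$ and $$ATV(\mu,\nu)>c\,\sqrt{2H(\mu|\nu)}.$$
   Context: For probability measures $\mu,\nu$ on a Polish space, $H(\mu|\nu)=\int \log\frac{d\mu}{d\nu}\,d\mu$ if $\mu\ll\nu$ and $H(\mu|\nu)=\infty$ otherwise (natural logarithm). Let $\mathcal X=\mathcal X_1\times\dots\times\mathcal X_n$ with each $\mathcal X_i$ Polish. For $k\le n$, $\mathcal F_k$ is the $\sigma$-algebra on $\mathcal X$ generated by the sets $A_1\times\dots\times A_k\times\mathcal X_{k+1}\times\dots\times\mathcal X_n$ with $A_i\subseteq\mathcal X_i$ Borel. $\mathrm{cpl}(\mu,\nu)$ is the set of Borel probability measures on $\mathcal X\times\mathcal X$ with first marginal $\mu$ and second marginal $\nu$. A coupling $\pi\in\mathrm{cpl}(\mu,\nu)$ with $\mu$-disintegration $\pi(dx,dy)=\mu(dx)\,\pi_x(dy)$ is called causal if for each $k\le n$ and each $B\in\mathcal F_k$ the map $x\mapsto\pi_x(B)$ is $\mathcal F_k$-measurable (up to $\mu$-null sets,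 as the disintegration is only determined $\mu$-a.e.). It is called bicausal if this condition holds both for its $\mu$-disintegration and, with the roles of the two coordinates exchanged, for its $\nu$-disintegration. $\mathrm{cpl}_{\mathrm{bc}}(\mu,\nu)$ denotes the set of bicausal couplings. With $\rho(x,y)=1$ if $x\ne y$ and $\rho(x,y)=0$ if $x=y$, the adapted total variation is $$ATV(\mu,\nu)=2\inf_{\pi\in\mathrm{cpl}_{\mathrm{bc}}(\mu,\nu)}\int\rho(x,y)\,d\pi(x,y).$$ *)

theory Defs
  imports "HOL-Probability.Probability"
begin

definition Polish_space :: "'a topology \<Rightarrow> bool" where
  "Polish_space T \<longleftrightarrow> completely_metrizable_space T \<and> separable_space T"

definition borel_of :: "'a topology \<Rightarrow> 'a measure" where
  "borel_of T = sigma (topspace T) {U. openin T U}"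

definition borel_probs :: "'a topology \<Rightarrow> 'a measure set" where
  "borel_probs T = {\<mu>. prob_space \<mu> \<and> sets \<mu> = sets (borel_of T)}"

text \<open>
  Relative entropy \<open>H(\<mu>|\<nu>)\<close>. For \<open>\<mu> \<lless> \<nu>\<close> the integral of
  \<open>log (d\<mu>/d\<nu>)\<close> against \<open>\<mu>\<close> is taken in the extended sense: the integral of the negative
  part is finite for probability measures, that of the positive part may be infinite.
  The constant \<open>KL_divergence\<close> is real-valued and would give 0 in the latter case.
  In \<open>absolutely_continuous\<close> and \<open>RN_deriv\<close> the reference measure comes first.
\<close>
definition rel_entropy :: "'a measure \<Rightarrow> 'a measure \<Rightarrow> ereal" where
  "rel_entropy \<mu> \<nu> =
     (if absolutely_continuous \<nu> \<mu>
      then enn2ereal (\<integral>\<^sup>+x. ennreal (ln (enn2real (RN_deriv \<nu> \<mu> x))) \<partial>\<mu>)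
         - enn2ereal (\<integral>\<^sup>+x. ennreal (- ln (enn2real (RN_deriv \<nu> \<mu> x))) \<partial>\<mu>)
      else \<infinity>)"

abbreviation product_space :: "nat \<Rightarrow> (nat \<Rightarrow> 'a topology) \<Rightarrow> (nat \<Rightarrow> 'a) topology" where
  "product_space n X \<equiv> product_topology X {1..n}"

definition filt :: "nat \<Rightarrow> (nat \<Rightarrow> 'a topology) \<Rightarrow> nat \<Rightarrow> (nat \<Rightarrow> 'a) measure" where
  "filt n X k = sigma (topspace (product_space n X))
     {PiE {1..n} (\<lambda>i. if i \<le> k then A i else topspace (X i)) | A.
        \<forall>i\<in>{1..k}. A i \<in> sets (borel_of (X i))}"

definition couplings :: "'a topology \<Rightarrow> 'a measure \<Rightarrow> 'a measure \<Rightarrow> ('a \<times> 'a) measure set" where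
  "couplings T \<mu> \<nu> = {\<pi> \<in> borel_probs (prod_topology T T).
     distr \<pi> (borel_of T) fst = \<mu> \<and> distr \<pi> (borel_of T) snd = \<nu>}"

text \<open>\<open>\<pi>(dx,dy) = \<mu>(dx) \<kappa>\<^sub>x(dy)\<close>, expressed on measurable rectangles.\<close>
definition disintegration ::
  "'a topology \<Rightarrow> 'a measure \<Rightarrow> ('a \<times> 'a) measure \<Rightarrow> ('a \<Rightarrow> 'a measure) \<Rightarrow> bool" where
  "disintegration T \<mu> \<pi> \<kappa> \<longleftrightarrow>
     \<kappa> \<in> \<mu> \<rightarrow>\<^sub>M prob_algebra (borel_of T) \<and>
     (\<forall>A\<in>sets (borel_of T). \<forall>B\<in>sets (borel_of T).
        emeasure \<pi> (A \<times> B) = (\<integral>\<^sup>+x\<in>A. emeasure (\<kappa> x) B \<partial>\<mu>))"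

text \<open>
  Disintegrations are \<open>\<mu>\<close>-a.e. unique, so it does not matter which one is used; measurability is
  accordingly required up to \<open>\<mu>\<close>-null sets.
\<close>
definition causal ::
  "nat \<Rightarrow> (nat \<Rightarrow> 'a topology) \<Rightarrow> (nat \<Rightarrow> 'a) measure \<Rightarrow> ((nat \<Rightarrow> 'a) \<times> (nat \<Rightarrow> 'a)) measure \<Rightarrow> bool"
  where
  "causal n X \<mu> \<pi> \<longleftrightarrow>
     (\<exists>\<kappa>. disintegration (product_space n X) \<mu> \<pi> \<kappa> \<and>
       (\<forall>k\<in>{1..n}. \<forall>B\<in>sets (filt n X k).
          \<exists>g\<in>borel_measurable (filt n X k). AE x in \<mu>. measure (\<kappa> x) B = (g x :: real)))"

definition swap_coupling :: "'a topology \<Rightarrow> ('a \<times> 'a) measure \<Rightarrow> ('a \<times> 'a) measure" where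
  "swap_coupling T \<pi> = distr \<pi> (borel_of (prod_topology T T)) (\<lambda>(x, y). (y, x))"

definition bicausal_couplings ::
  "nat \<Rightarrow> (nat \<Rightarrow> 'a topology) \<Rightarrow> (nat \<Rightarrow> 'a) measure \<Rightarrow> (nat \<Rightarrow> 'a) measure
    \<Rightarrow> ((nat \<Rightarrow> 'a) \<times> (nat \<Rightarrow> 'a)) measure set" where
  "bicausal_couplings n X \<mu> \<nu> =
     {\<pi> \<in> couplings (product_space n X) \<mu> \<nu>.
        causal n X \<mu> \<pi> \<and> causal n X \<nu> (swap_coupling (product_space n X) \<pi>)}"

text \<open>
  For Borel probability measures on a product of Polish spaces the infimum is over a nonempty set
  (it contains the product coupling) of integrals of a bounded Borel function, so working in
  \<open>real\<close> is harmless.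
\<close>
definition ATV ::
  "nat \<Rightarrow> (nat \<Rightarrow> 'a topology) \<Rightarrow> (nat \<Rightarrow> 'a) measure \<Rightarrow> (nat \<Rightarrow> 'a) measure \<Rightarrow> real" where
  "ATV n X \<mu> \<nu> =
     2 * (INF \<pi>\<in>bicausal_couplings n X \<mu> \<nu>. \<integral>z. (if fst z \<noteq> snd z then 1 else 0) \<partial>\<pi>)"

text \<open>
  A Polish space has at most the cardinality of the continuum, so up to homeomorphism every
  Polish space is a topology whose underlying set is a subset of \<open>real\<close> (not necessarily
  carrying the Euclidean topology). Existential quantification over \<open>real topology\<close> is thus
  quantification over all Polish spaces.
\<close>

end

(* Take for \<mu> the law of n independent coins of bias 1/2 + t and for \<nu> that of n fair coins. Entropy
   is additive over the coins, so H(\<mu>|\<nu>) = 2 n t^2 (1 + o(1)). Under a bicausal coupling the next coin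
   of either sequence is independent of the joint past, so two sequences that have agreed so far
   agree at the next coin with probability at most 1 - t; hence ATV >= 2 (1 - (1 - t)^n) = 2 n t (1 + o(1)),
   and the ratio of ATV to sqrt (2 H) tends to sqrt n as t tends to 0. *)
theory Submission
  imports Defs "HOL-Real_Asymp.Real_Asymp"
begin

section \<open>Discrete products and the filtration\<close>

text \<open>Since \<open>I\<close> is finite, each singleton is an open box, and a topology in which
  all singletons are open is discrete.\<close>

lemma product_topology_discrete_topology:
  assumes "finite I"
  shows "product_topology (\<lambda>i. discrete_topology (S i)) I = discrete_topology (PiE I S)"
proof -
  have "openin (product_topology (\<lambda>i. discrete_topology (S i)) I) {x}" if x: "x \<in> PiE I S" for x
  proof -
  have "{x} = (\<Pi>\<^sub>E i\<in>I. {x i})"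
    using x by (simp add: PiE_singleton PiE_iff)
  then show ?thesis
    using x assms by (auto simp: openin_PiE_gen)
  qed
  then have "discrete_topology (PiE I S) = product_topology (\<lambda>i. discrete_topology (S i)) I"
    by (simp add: discrete_topology_unique)
  then show ?thesis ..
qed

lemma sets_borel_of_discrete [simp]: "sets (borel_of (discrete_topology S)) = Pow S"
  by (simp add: borel_of_def Pow_def[symmetric] sigma_sets_top sigma_algebra.sigma_sets_eq sigma_algebra_Pow)

lemma space_borel_of_discrete [simp]: "space (borel_of (discrete_topology S)) = S"
  by (simp add: borel_of_def space_measure_of_conv)

text \<open>The sets that do not separate \<open>x\<close> from \<open>y\<close> are closed under
  complements and countable unions.\<close>

lemma sigma_sets_separates:
  assumes "A \<in> sigma_sets \<Omega> G" and "\<And>B. B \<in> G \<Longrightarrow> x \<in> B \<longleftrightarrow> y \<in> B" and "x \<in> \<Omega>" "y \<in> \<Omega>"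
  shows "x \<in> A \<longleftrightarrow> y \<in> A"
  using assms(1) by induction (use assms in auto)

text \<open>Turns measurability at time \<open>k\<close> into a pointwise statement. The level set
  of \<open>g\<close> through \<open>x\<close> lies in the generated sigma-algebra, and no generator
  separates two points whose first \<open>k\<close> coordinates coincide.\<close>

lemma filt_measurable_cong:
  fixes g :: "(nat \<Rightarrow> 'a) \<Rightarrow> real"
  assumes "g \<in> borel_measurable (filt n X k)"
    and "x \<in> topspace (product_space n X)" "y \<in> topspace (product_space n X)"
    and "\<And>i. i \<in> {1..n} \<Longrightarrow> i \<le> k \<Longrightarrow> x i = y i"
  shows "g x = g y"
proof -
  let ?G = "{PiE {1..n} (\<lambda>i. if i \<le> k then A i else topspace (X i)) | A.
        \<forall>i\<in>{1..k}. A i \<in> sets (borel_of (X i))}"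
  let ?\<Omega> = "topspace (product_space n X)"
  have "sets (borel_of (X i)) \<subseteq> Pow (topspace (X i))" for i
    using sets.space_closed[of "borel_of (X i)"] by (simp add: borel_of_def space_measure_of_conv)
  then have G: "?G \<subseteq> Pow ?\<Omega>"
    by (fastforce simp: PiE_iff split: if_splits)
  have "g -` {g x} \<inter> ?\<Omega> \<in> sigma_sets ?\<Omega> ?G"
    using measurable_sets[OF assms(1), of "{g x}"] G by (simp add: filt_def)
  then have "x \<in> g -` {g x} \<inter> ?\<Omega> \<longleftrightarrow> y \<in> g -` {g x} \<inter> ?\<Omega>"
  proof (rule sigma_sets_separates)
    fix B assume "B \<in> ?G"
    then obtain A where B: "B = PiE {1..n} (\<lambda>i. if i \<le> k then A i else topspace (X i))"
      by blast
    have "x i \<in> (if i \<le> k then A i else topspace (X i)) \<longleftrightarrow>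
        y i \<in> (if i \<le> k then A i else topspace (X i))" if "i \<in> {1..n}" for i
      using assms(2-4) that by (auto simp: PiE_iff)
    moreover have "x \<in> extensional {1..n}" "y \<in> extensional {1..n}"
      using assms(2,3) by (auto simp: PiE_iff)
    ultimately show "x \<in> B \<longleftrightarrow> y \<in> B"
      unfolding B PiE_iff by blast
  qed (use assms in auto)
  then show ?thesis
    using assms(2,3) by auto
qed

section \<open>Relative entropy and probability measures on finite sets\<close>

text \<open>The quotient \<open>p x / q x\<close> is a density. The Radon-Nikodym derivative is
  unique only almost everywhere, but each point of \<open>S\<close> has positive mass, so it equals
  the quotient at every point of \<open>S\<close>.\<close>

lemma rel_entropy_point_measure:
  fixes p q :: "'a \<Rightarrow> real"
  assumes S: "finite S" and p: "\<And>x. x \<in> S \<Longrightarrow> 0 < p x" and q: "\<And>x. x \<in> S \<Longrightarrow> 0 < q x"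
  shows "rel_entropy (point_measure S p) (point_measure S q) = ereal (\<Sum>x\<in>S. p x * ln (p x / q x))"
proof -
  let ?M = "point_measure S p" and ?N = "point_measure S q"
  have dens: "density ?N (\<lambda>x. ennreal (p x / q x)) = ?M"
  proof (rule measure_eqI)
    fix A assume "A \<in> sets (density ?N (\<lambda>x. ennreal (p x / q x)))"
    then have A: "A \<subseteq> S" by (simp add: sets_point_measure)
    then have "emeasure (density ?N (\<lambda>x. ennreal (p x / q x))) A
        = (\<Sum>x\<in>S. ennreal (q x) * (ennreal (p x / q x) * indicator A x))"
      using S by (simp add: emeasure_density sets_point_measure nn_integral_point_measure_finite)
    also have "\<dots> = (\<Sum>x\<in>A. ennreal (p x))"
      using A S p q
      by (intro sum.mono_neutral_cong_right)
         (auto simp: indicator_def ennreal_mult[symmetric] subset_iff less_imp_le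
            dest!: p q less_imp_neq[OF q] simp del: ennreal_eq_0_iff)
    finally show "emeasure (density ?N (\<lambda>x. ennreal (p x / q x))) A = emeasure ?M A"
      using A S by (simp add: emeasure_point_measure_finite)
  qed (simp add: sets_point_measure)
  have "finite_measure ?N"
    using S by (intro finite_measureI) (simp add: space_point_measure emeasure_point_measure_finite)
  then interpret N: finite_measure ?N .
  have "AE x in ?N. ennreal (p x / q x) = RN_deriv ?N ?M x"
    by (rule N.RN_deriv_unique[OF _ dens]) simp
  then have "RN_deriv ?N ?M x = ennreal (p x / q x)" if "x \<in> S" for x
    using that q[OF that] unfolding AE_point_measure by simp
  then have RN: "enn2real (RN_deriv ?N ?M x) = p x / q x" if "x \<in> S" for x
    using p[OF that] q[OF that] that by simp
  have ac: "absolutely_continuous ?N ?M"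
    unfolding dens[symmetric] by (rule absolutely_continuousI_density) simp
  \<comment> \<open>Used for \<open>ln\<close> and for its negative. Since \<open>ennreal\<close>
    sends negative reals to 0, these are the positive and negative parts; both integrals are finite,
    so their difference can be taken in the reals.\<close>
  have int: "(\<integral>\<^sup>+x. ennreal (f (enn2real (RN_deriv ?N ?M x))) \<partial>?M)
       = ennreal (\<Sum>x\<in>S. p x * max 0 (f (p x / q x)))" for f
  proof -
    have "(\<integral>\<^sup>+x. ennreal (f (enn2real (RN_deriv ?N ?M x))) \<partial>?M)
        = (\<Sum>x\<in>S. ennreal (p x * max 0 (f (p x / q x))))"
      unfolding nn_integral_point_measure_finite[OF S]
    proof (rule sum.cong[OF refl])
      fix x assume x: "x \<in> S"
      have "ennreal (f (p x / q x)) = ennreal (max 0 (f (p x / q x)))"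
        by (simp add: max_def ennreal_neg)
      then show "ennreal (p x) * ennreal (f (enn2real (RN_deriv ?N ?M x)))
          = ennreal (p x * max 0 (f (p x / q x)))"
        using p[OF x] by (simp add: RN[OF x] ennreal_mult')
    qed
    then show ?thesis
      using p by (simp add: sum_ennreal less_imp_le)
  qed
  have "rel_entropy ?M ?N = ereal ((\<Sum>x\<in>S. p x * max 0 (ln (p x / q x)))
        - (\<Sum>x\<in>S. p x * max 0 (- ln (p x / q x))))"
    unfolding rel_entropy_def using ac int[of ln] int[of "\<lambda>x. - ln x"] p
    by (simp add: sum_nonneg less_imp_le enn2ereal_ennreal)
  also have "\<dots> = ereal (\<Sum>x\<in>S. p x * ln (p x / q x))"
    unfolding sum_subtractf[symmetric] right_diff_distrib[symmetric]
    by (intro arg_cong[of _ _ ereal] sum.cong) (auto simp: max_def)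
  finally show ?thesis .
qed

lemma point_measure_borel_probs:
  fixes p :: "'a \<Rightarrow> real"
  assumes "finite S" "\<And>x. x \<in> S \<Longrightarrow> 0 \<le> p x" "(\<Sum>x\<in>S. p x) = 1"
  shows "point_measure S p \<in> borel_probs (discrete_topology S)"
  using assms unfolding borel_probs_def
  by (auto intro!: prob_spaceI simp: sets_point_measure space_point_measure emeasure_point_measure_finite sum_ennreal)

section \<open>Consequences of causality\<close>

text \<open>Let \<open>C\<close> fix the first \<open>k\<close> coordinates. By causality
  \<open>\<kappa> x\<close> gives \<open>C\<close> a mass that is almost everywhere a function of
  these coordinates, hence constant on \<open>C\<close>. Integrating over \<open>A\<close> inside
  \<open>C\<close> gives a factor \<open>\<gamma>\<close> independent of \<open>A\<close>: once both
  pasts are fixed, the first coordinate keeps its conditional law under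
  \<open>\<mu>\<close>.\<close>

lemma causal_cylinder:
  fixes X :: "nat \<Rightarrow> 'a topology" and n :: nat
  defines "T \<equiv> product_space n X"
  assumes causal: "causal n X \<mu> \<pi>" and \<mu>: "sets \<mu> = sets (borel_of T)"
    and k: "k \<le> n" and a: "\<And>i. i \<in> {1..k} \<Longrightarrow> {a i} \<in> sets (borel_of (X i))"
    and C_def: "C = PiE {1..n} (\<lambda>i. if i \<le> k then {a i} else topspace (X i))"
    and C: "C \<in> sets (borel_of T)"
  shows "\<exists>\<gamma>. \<forall>A\<in>sets (borel_of T). A \<subseteq> C \<longrightarrow> measure \<pi> (A \<times> C) = \<gamma> * measure \<mu> A"
proof (cases "C = {}")
  case False
  then obtain c where c: "c \<in> C" by blast
  obtain \<kappa> where \<kappa>: "\<kappa> \<in> \<mu> \<rightarrow>\<^sub>M prob_algebra (borel_of T)"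
    and dis: "\<And>A B. A \<in> sets (borel_of T) \<Longrightarrow> B \<in> sets (borel_of T) \<Longrightarrow>
        emeasure \<pi> (A \<times> B) = (\<integral>\<^sup>+x\<in>A. emeasure (\<kappa> x) B \<partial>\<mu>)"
    and ad: "\<And>k B. k \<in> {1..n} \<Longrightarrow> B \<in> sets (filt n X k) \<Longrightarrow>
        \<exists>g\<in>borel_measurable (filt n X k). AE x in \<mu>. measure (\<kappa> x) B = (g x :: real)"
    using causal unfolding causal_def disintegration_def T_def by blast
  have prob: "prob_space (\<kappa> x)" "sets (\<kappa> x) = sets (borel_of T)" if "x \<in> space \<mu>" for x
    using measurable_space[OF \<kappa> that] by (simp_all add: space_prob_algebra)
  have C_sub: "C \<subseteq> topspace T"
    using sets.sets_into_space[OF C] by (simp add: borel_of_def space_measure_of_conv)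
  have "\<exists>r. AE x in \<mu>. x \<in> C \<longrightarrow> measure (\<kappa> x) C = r"
  proof (cases "k = 0")
    \<comment> \<open>Causality speaks only of times from 1 on. At time 0 the cylinder is the whole
      space, and every \<open>\<kappa> x\<close> gives it mass 1.\<close>
    case True
    then have "C = topspace T"
      unfolding C_def T_def topspace_product_topology by (intro PiE_cong) auto
    then have "measure (\<kappa> x) C = 1" if "x \<in> space \<mu>" for x
      using prob_space.prob_space[OF prob(1)[OF that]] sets_eq_imp_space_eq[OF prob(2)[OF that]]
      by (simp add: borel_of_def space_measure_of_conv)
    then show ?thesis by (intro exI[of _ 1]) auto
  next
    case False
    have "{PiE {1..n} (\<lambda>i. if i \<le> k then A i else topspace (X i)) | A.
        \<forall>i\<in>{1..k}. A i \<in> sets (borel_of (X i))} \<subseteq> Pow (topspace (product_space n X))"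
      using sets.sets_into_space[of _ "borel_of (X _)"]
      by (fastforce simp: PiE_iff borel_of_def space_measure_of_conv split: if_splits)
    then have "C \<in> sets (filt n X k)"
      unfolding filt_def C_def using a by (auto intro!: sigma_sets.Basic)
    then obtain g where g: "g \<in> borel_measurable (filt n X k)"
        and AE_g: "AE x in \<mu>. measure (\<kappa> x) C = g x"
      using ad[of k C] False k by auto
    have "g x = g c" if "x \<in> C" for x
    proof (rule filt_measurable_cong[OF g])
      show "x \<in> topspace (product_space n X)" "c \<in> topspace (product_space n X)"
        using that c C_sub unfolding T_def by auto
      show "x i = c i" if i: "i \<in> {1..n}" "i \<le> k" for i
        using i c \<open>x \<in> C\<close> unfolding C_def PiE_iff by fastforce
    qed
    with AE_g show ?thesis
      by (intro exI[of _ "g c"]) (auto elim: AE_mp)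
  qed
  then obtain r where r: "AE x in \<mu>. x \<in> C \<longrightarrow> measure (\<kappa> x) C = r" by blast
  \<comment> \<open>If \<open>C\<close> is a null set, nothing is known about the sign of
    \<open>r\<close>; the factor is therefore its nonnegative part.\<close>
  have "measure \<pi> (A \<times> C) = enn2real (ennreal r) * measure \<mu> A"
    if A: "A \<in> sets (borel_of T)" "A \<subseteq> C" for A
  proof -
    have "emeasure \<pi> (A \<times> C) = (\<integral>\<^sup>+x\<in>A. emeasure (\<kappa> x) C \<partial>\<mu>)"
      by (rule dis[OF A(1) C])
    also have "\<dots> = (\<integral>\<^sup>+x. ennreal r * indicator A x \<partial>\<mu>)"
    proof (rule nn_integral_cong_AE)
      show "AE x in \<mu>. emeasure (\<kappa> x) C * indicator A x = ennreal r * indicator A x"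
        using r AE_space
      proof eventually_elim
        case (elim x)
        interpret prob_space "\<kappa> x" using prob(1) elim(2) .
        show ?case
          using elim A(2) by (auto simp: indicator_def emeasure_eq_measure)
      qed
    qed
    also have "\<dots> = ennreal r * emeasure \<mu> A"
      using A \<mu> by (simp add: nn_integral_cmult_indicator)
    finally show ?thesis
      by (simp add: measure_def enn2real_mult)
  qed
  then show ?thesis by blast
qed auto

section \<open>The product coupling\<close>

text \<open>The disintegration is the constant kernel \<open>\<nu>\<close>, and constants are
  measurable at every time.\<close>

lemma product_coupling_causal:
  assumes \<mu>: "\<mu> \<in> borel_probs (product_space n X)" and \<nu>: "\<nu> \<in> borel_probs (product_space n X)"
  shows "causal n X \<mu> (\<mu> \<Otimes>\<^sub>M \<nu>)"
proof -
  interpret \<nu>: prob_space \<nu> using \<nu> by (simp add: borel_probs_def)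
  show ?thesis
    unfolding causal_def disintegration_def
  proof (intro exI[of _ "\<lambda>_. \<nu>"] conjI ballI)
    show "(\<lambda>_. \<nu>) \<in> \<mu> \<rightarrow>\<^sub>M prob_algebra (borel_of (product_space n X))"
      using \<nu> by (intro measurable_const) (simp add: space_prob_algebra borel_probs_def)
    show "emeasure (\<mu> \<Otimes>\<^sub>M \<nu>) (A \<times> B) = (\<integral>\<^sup>+x\<in>A. emeasure \<nu> B \<partial>\<mu>)"
      if "A \<in> sets (borel_of (product_space n X))" "B \<in> sets (borel_of (product_space n X))" for A B
      using that \<mu> \<nu>
      by (simp add: borel_probs_def \<nu>.emeasure_pair_measure_Times nn_integral_cmult_indicator mult.commute[of "emeasure \<mu> A"])
    show "\<exists>g\<in>borel_measurable (filt n X k). AE x in \<mu>. measure \<nu> B = (g x :: real)" for k B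
      by (intro bexI[of _ "\<lambda>_. measure \<nu> B"]) auto
  qed
qed

text \<open>Provides a member of the set over which \<open>ATV\<close> takes its infimum. The swap
  of the product coupling is the product in the other order, so causality in both directions is the
  same fact. The assumption \<open>sets_prod\<close> relates the Borel sets of the product topology,
  used for couplings, to the product sigma-algebra carried by the product measure.\<close>

lemma product_coupling_bicausal:
  assumes \<mu>: "\<mu> \<in> borel_probs (product_space n X)" and \<nu>: "\<nu> \<in> borel_probs (product_space n X)"
    and sets_prod: "sets (borel_of (prod_topology (product_space n X) (product_space n X)))
      = sets (borel_of (product_space n X) \<Otimes>\<^sub>M borel_of (product_space n X))"
  shows "\<mu> \<Otimes>\<^sub>M \<nu> \<in> bicausal_couplings n X \<mu> \<nu>"
proof -
  let ?T = "product_space n X"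
  interpret \<mu>: prob_space \<mu> using \<mu> by (simp add: borel_probs_def)
  interpret \<nu>: prob_space \<nu> using \<nu> by (simp add: borel_probs_def)
  interpret \<mu>\<nu>: pair_prob_space \<mu> \<nu> ..
  interpret \<nu>\<mu>: pair_prob_space \<nu> \<mu> ..
  have sets: "sets \<mu> = sets (borel_of ?T)" "sets \<nu> = sets (borel_of ?T)"
    using \<mu> \<nu> by (simp_all add: borel_probs_def)
  have sets_pair: "sets (\<mu> \<Otimes>\<^sub>M \<nu>) = sets (borel_of (prod_topology ?T ?T))"
      "sets (\<nu> \<Otimes>\<^sub>M \<mu>) = sets (borel_of (prod_topology ?T ?T))"
    unfolding sets_prod by (rule sets_pair_measure_cong; fact sets)+
  have "distr (\<mu> \<Otimes>\<^sub>M \<nu>) (borel_of ?T) fst = distr (\<mu> \<Otimes>\<^sub>M \<nu>) \<mu> fst"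
    by (rule distr_cong) (simp_all add: sets)
  moreover have "distr (\<mu> \<Otimes>\<^sub>M \<nu>) (borel_of ?T) snd = distr (\<mu> \<Otimes>\<^sub>M \<nu>) \<nu> snd"
    by (rule distr_cong) (simp_all add: sets)
  moreover have "distr (\<mu> \<Otimes>\<^sub>M \<nu>) \<nu> snd = distr (\<nu> \<Otimes>\<^sub>M \<mu>) \<nu> fst"
    by (subst \<mu>\<nu>.distr_pair_swap) (simp add: distr_distr comp_def case_prod_beta')
  moreover have swap: "swap_coupling ?T (\<mu> \<Otimes>\<^sub>M \<nu>) = \<nu> \<Otimes>\<^sub>M \<mu>"
    unfolding swap_coupling_def
    by (subst \<nu>\<mu>.distr_pair_swap) (rule distr_cong, simp_all add: sets_pair)
  ultimately show ?thesis
    using product_coupling_causal[OF \<mu> \<nu>] product_coupling_causal[OF \<nu> \<mu>] sets_pair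
      \<mu>.distr_pair_fst[of \<nu>] \<nu>.distr_pair_fst[of \<mu>]
    by (simp add: bicausal_couplings_def couplings_def borel_probs_def prob_space_pair
        \<mu>.prob_space_axioms \<nu>.prob_space_axioms)
qed

section \<open>Independent coins and their entropy\<close>

text \<open>The parameter \<open>t\<close> is the excess over the fair coin, so \<open>t = 0\<close>
  gives the second measure from the same family.\<close>

definition weight :: "real \<Rightarrow> real \<Rightarrow> real" where
  "weight t b = (if b = 1 then 1/2 + t else 1/2 - t)"

definition biased_coins :: "nat \<Rightarrow> real \<Rightarrow> (nat \<Rightarrow> real) measure" where
  "biased_coins n t = point_measure ({1..n} \<rightarrow>\<^sub>E {0, 1}) (\<lambda>x. \<Prod>i\<in>{1..n}. weight t (x i))"

lemma weight_nonneg: "\<bar>t\<bar> < 1/2 \<Longrightarrow> 0 \<le> weight t b"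
  and weight_pos: "\<bar>t\<bar> < 1/2 \<Longrightarrow> 0 < weight t b"
  by (auto simp: weight_def abs_if split: if_splits)

lemma sum_weight [simp]: "(\<Sum>b\<in>{0, 1}. weight t b) = 1"
  by (simp add: weight_def)

lemma sets_biased_coins [simp]: "sets (biased_coins n t) = Pow ({1..n} \<rightarrow>\<^sub>E {0, 1})"
  by (simp add: biased_coins_def sets_point_measure)

lemma space_biased_coins [simp]: "space (biased_coins n t) = {1..n} \<rightarrow>\<^sub>E {0, 1}"
  by (simp add: biased_coins_def space_point_measure)

lemma finite_cube [simp]: "finite ({m..n::nat} \<rightarrow>\<^sub>E {0, 1::real})"
  by (rule finite_PiE) auto

lemma measure_biased_coins_PiE:
  assumes "\<bar>t\<bar> < 1/2" and B: "\<And>i. i \<in> {1..n} \<Longrightarrow> B i \<subseteq> {0, 1}"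
  shows "measure (biased_coins n t) (PiE {1..n} B) = (\<Prod>i\<in>{1..n}. \<Sum>b\<in>B i. weight t b)"
proof -
  have "PiE {1..n} B \<subseteq> {1..n} \<rightarrow>\<^sub>E {0, 1}"
    using B by (rule PiE_mono)
  then have "measure (biased_coins n t) (PiE {1..n} B)
      = (\<Sum>x\<in>PiE {1..n} B. \<Prod>i\<in>{1..n}. weight t (x i))"
    unfolding biased_coins_def using weight_nonneg[OF assms(1)]
    by (subst measure_point_measure_finite_if) (auto intro!: prod_nonneg)
  also have "\<dots> = (\<Prod>i\<in>{1..n}. \<Sum>b\<in>B i. weight t b)"
    using B by (intro prod_sum_PiE[symmetric]) (auto intro: finite_subset)
  finally show ?thesis .
qed

text \<open>Independence of coin \<open>j\<close>: in the product formula only factor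
  \<open>j\<close> changes, from 1 to \<open>weight t b\<close>.\<close>

lemma measure_biased_coins_fun_upd:
  assumes "\<bar>t\<bar> < 1/2" and B: "\<And>i. i \<in> {1..n} \<Longrightarrow> B i \<subseteq> {0, 1}"
    and j: "j \<in> {1..n}" "B j = {0, 1}" and b: "b \<in> {0, 1}"
  shows "measure (biased_coins n t) (PiE {1..n} (B(j := {b})))
    = weight t b * measure (biased_coins n t) (PiE {1..n} B)"
proof -
  have "measure (biased_coins n t) (PiE {1..n} (B(j := {b})))
      = weight t b * (\<Prod>i\<in>{1..n} - {j}. \<Sum>b\<in>B i. weight t b)"
    using assms by (subst measure_biased_coins_PiE) (auto simp: prod.remove[of _ j])
  moreover have "measure (biased_coins n t) (PiE {1..n} B) = (\<Prod>i\<in>{1..n} - {j}. \<Sum>b\<in>B i. weight t b)"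
    using assms(1,2) j sum_weight by (subst measure_biased_coins_PiE) (auto simp: prod.remove[of _ j] simp del: sum.insert)
  ultimately show ?thesis by simp
qed

text \<open>Marginalisation: \<open>f\<close> is absorbed into factor \<open>j\<close>, sum and
  product are exchanged, and every other factor sums to 1.\<close>

lemma sum_prod_weight:
  fixes n j :: nat and f :: "real \<Rightarrow> real"
  assumes j: "j \<in> {1..n}"
  shows "(\<Sum>x\<in>{1..n} \<rightarrow>\<^sub>E {0, 1}. (\<Prod>i\<in>{1..n}. weight t (x i)) * f (x j))
    = (\<Sum>b\<in>{0, 1}. weight t b * f b)"
proof -
  have "(\<Sum>x\<in>{1..n} \<rightarrow>\<^sub>E {0, 1}. (\<Prod>i\<in>{1..n}. weight t (x i)) * f (x j))
      = (\<Sum>x\<in>{1..n} \<rightarrow>\<^sub>E {0, 1}. \<Prod>i\<in>{1..n}. weight t (x i) * (if i = j then f (x i) else 1))"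
    using j by (intro sum.cong refl) (simp add: prod.distrib)
  also have "\<dots> = (\<Prod>i\<in>{1..n}. \<Sum>b\<in>{0, 1}. weight t b * (if i = j then f b else 1))"
    by (rule prod_sum_PiE[symmetric]) auto
  also have "\<dots> = (\<Prod>i\<in>{1..n}. if i = j then \<Sum>b\<in>{0, 1}. weight t b * f b else 1)"
    by (intro prod.cong) (auto simp: weight_def)
  also have "\<dots> = (\<Sum>b\<in>{0, 1}. weight t b * f b)"
    using j by simp
  finally show ?thesis .
qed

lemma biased_coins_borel_probs:
  assumes "\<bar>t\<bar> < 1/2"
  shows "biased_coins n t \<in> borel_probs (discrete_topology ({1..n} \<rightarrow>\<^sub>E {0, 1}))"
  unfolding biased_coins_def
proof (rule point_measure_borel_probs)
  have "(\<Prod>i\<in>{1..n}. \<Sum>b\<in>{0, 1}. weight t b) = (\<Sum>x\<in>{1..n} \<rightarrow>\<^sub>E {0, 1}. \<Prod>i\<in>{1..n}. weight t (x i))"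
    by (rule prod_sum_PiE) auto
  then show "(\<Sum>x\<in>{1..n} \<rightarrow>\<^sub>E {0, 1}. \<Prod>i\<in>{1..n}. weight t (x i)) = 1"
    by (simp only: sum_weight prod.neutral_const)
qed (use weight_nonneg[OF assms] in \<open>auto intro: prod_nonneg\<close>)

text \<open>The logarithm of the quotient of products is a sum over the coins, and each summand sees
  one coin only. The fair weight 1/2 turns the quotients into \<open>1 + 2*t\<close> and
  \<open>1 - 2*t\<close>.\<close>

lemma rel_entropy_biased_coins:
  assumes t: "\<bar>t\<bar> < 1/2"
  shows "rel_entropy (biased_coins n t) (biased_coins n 0)
    = ereal (real n * ((1/2 + t) * ln (1 + 2*t) + (1/2 - t) * ln (1 - 2*t)))"
proof -
  let ?\<Omega> = "{1..n} \<rightarrow>\<^sub>E {0, 1::real}"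
  let ?w = "\<lambda>s x. \<Prod>i\<in>{1..n}. weight s (x i)"
  have ln: "ln (?w t x / ?w 0 x) = (\<Sum>j\<in>{1..n}. ln (weight t (x j) / weight 0 (x j)))" for x
    unfolding prod_dividef[symmetric]
    by (rule ln_prod) (use weight_pos[OF t, THEN less_imp_neq] weight_pos[of 0, THEN less_imp_neq] in auto)
  have "(\<Sum>x\<in>?\<Omega>. ?w t x * ln (?w t x / ?w 0 x))
      = (\<Sum>j\<in>{1..n}. \<Sum>x\<in>?\<Omega>. ?w t x * ln (weight t (x j) / weight 0 (x j)))"
    unfolding ln sum_distrib_left by (rule sum.swap)
  also have "\<dots> = (\<Sum>j\<in>{1..n}. \<Sum>b\<in>{0, 1}. weight t b * ln (weight t b / weight 0 b))"
    by (intro sum.cong refl sum_prod_weight)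
  also have "\<dots> = real n * ((1/2 + t) * ln (1 + 2*t) + (1/2 - t) * ln (1 - 2*t))"
    by (simp add: weight_def algebra_simps)
  finally show ?thesis
    unfolding biased_coins_def
    by (subst rel_entropy_point_measure) (auto intro!: prod_pos weight_pos t)
qed

section \<open>Agreement under bicausal couplings\<close>

lemma measure_swap_coupling_Times:
  assumes "\<pi> \<in> borel_probs (prod_topology (discrete_topology S) (discrete_topology S))"
    and "A \<subseteq> S" "B \<subseteq> S"
  shows "measure (swap_coupling (discrete_topology S) \<pi>) (A \<times> B) = measure \<pi> (B \<times> A)"
proof -
  have \<pi>: "sets \<pi> = Pow (S \<times> S)"
    using assms(1) by (simp add: borel_probs_def flip: prod_topology_discrete_topology)
  then have sp: "space \<pi> = S \<times> S"
    using sets_eq_imp_space_eq[of \<pi> "count_space (S \<times> S)"] by simp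
  have "(\<lambda>(x, y). (y, x)) -` (A \<times> B) \<inter> space \<pi> = B \<times> A"
    using assms(2,3) sp by auto
  moreover have "(\<lambda>(x, y). (y, x)) \<in> \<pi> \<rightarrow>\<^sub>M borel_of (prod_topology (discrete_topology S) (discrete_topology S))"
    unfolding prod_topology_discrete_topology[symmetric]
    by (rule measurableI) (auto simp: \<pi> sp)
  ultimately show ?thesis
    using assms(2,3) unfolding swap_coupling_def
    by (subst measure_distr) (auto simp flip: prod_topology_discrete_topology)
qed

text \<open>Bicausality makes the next coin of either sequence independent of the joint past, so whatever
  the common past, the next coins differ with probability at least their total variation distance.\<close>
lemma bicausal_agreement_step:
  fixes n :: nat
  defines "X \<equiv> \<lambda>_::nat. discrete_topology {0, 1::real}"
  defines "\<Omega> \<equiv> {1..n} \<rightarrow>\<^sub>E {0, 1::real}"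
  defines "D \<equiv> \<lambda>k. {z \<in> \<Omega> \<times> \<Omega>. \<forall>i\<in>{1..k}. fst z i = snd z i}"
  assumes t: "0 \<le> t" "t < 1/2" and k: "k < n"
    and \<pi>: "\<pi> \<in> bicausal_couplings n X (biased_coins n t) (biased_coins n 0)"
  shows "measure \<pi> (D (Suc k)) \<le> (1 - t) * measure \<pi> (D k)"
proof -
  let ?T = "discrete_topology \<Omega>" and ?\<mu> = "biased_coins n t" and ?\<nu> = "biased_coins n 0"
  let ?\<pi>' = "swap_coupling ?T \<pi>"
  have T: "product_space n X = ?T"
    unfolding X_def \<Omega>_def by (rule product_topology_discrete_topology) simp
  have probs: "\<pi> \<in> borel_probs (prod_topology ?T ?T)"
    and causal: "causal n X ?\<mu> \<pi>" "causal n X ?\<nu> ?\<pi>'"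
    using \<pi> unfolding bicausal_couplings_def couplings_def T by auto
  then have sets_\<pi>: "sets \<pi> = Pow (\<Omega> \<times> \<Omega>)"
    by (simp add: borel_probs_def flip: prod_topology_discrete_topology)
  interpret prob_space \<pi> using probs by (simp add: borel_probs_def)
  \<comment> \<open>For each common past \<open>a\<close>, the cylinder \<open>C a\<close> collects
    its continuations, and \<open>C1 a\<close> those whose next coin shows 1. The squares of the
    cylinders \<open>C a\<close> will partition \<open>D k\<close>, so the estimate is proved on
    each square and then summed.\<close>
  define box where "box a = (\<lambda>i. if i \<le> k then {a i} else {0, 1::real})" for a :: "nat \<Rightarrow> real"
  define C where "C a = PiE {1..n} (box a)" for a
  define C1 where "C1 a = PiE {1..n} ((box a)(Suc k := {1}))" for a
  let ?I = "{1..k} \<rightarrow>\<^sub>E {0, 1::real}"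
  have step: "measure \<pi> (D (Suc k) \<inter> C a \<times> C a) \<le> (1 - t) * measure \<pi> (C a \<times> C a)"
    if a: "a \<in> ?I" for a
  proof -
    have a01: "a i \<in> {0, 1}" if "i \<in> {1..k}" for i
      using a that by (auto simp: PiE_iff)
    then have box: "box a i \<subseteq> {0, 1}" if "i \<in> {1..n}" for i
      using that by (auto simp: box_def)
    have C_sub: "C a \<subseteq> \<Omega>"
      unfolding C_def \<Omega>_def using box by (rule PiE_mono)
    have C1_iff: "x \<in> C1 a \<longleftrightarrow> x \<in> C a \<and> x (Suc k) = 1" for x
      using k by (auto simp: C1_def C_def box_def PiE_iff)
    then have C1_sub: "C1 a \<subseteq> C a" by blast
    have coin: "measure (biased_coins n s) (C1 a) = (1/2 + s) * measure (biased_coins n s) (C a)"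
      if "\<bar>s\<bar> < 1/2" for s
      unfolding C_def C1_def using that k box
      by (subst measure_biased_coins_fun_upd) (auto simp: weight_def box_def)
    \<comment> \<open>The unknown factor \<open>\<gamma>\<close> is eliminated by comparing
      \<open>C1 a\<close> with \<open>C a\<close>. The statement is kept general in \<open>s\<close>
      and \<open>\<rho>\<close> to serve both \<open>\<pi>\<close> with bias \<open>t\<close> and
      its swap with bias 0.\<close>
    have cyl: "measure \<rho> (C1 a \<times> C a) = (1/2 + s) * measure \<rho> (C a \<times> C a)"
      if "causal n X (biased_coins n s) \<rho>" "\<bar>s\<bar> < 1/2" for s \<rho>
    proof -
      have "\<exists>\<gamma>. \<forall>A\<in>sets (borel_of (product_space n X)). A \<subseteq> C a \<longrightarrow>
          measure \<rho> (A \<times> C a) = \<gamma> * measure (biased_coins n s) A"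
        using that(1) _ less_imp_le[OF k]
      proof (rule causal_cylinder[where a = a])
        show "{a i} \<in> sets (borel_of (X i))" if "i \<in> {1..k}" for i
          using a01[OF that] by (simp add: X_def)
        show "C a = PiE {1..n} (\<lambda>i. if i \<le> k then {a i} else topspace (X i))"
          unfolding C_def box_def X_def topspace_discrete_topology ..
      qed (use C_sub in \<open>simp_all only: T sets_biased_coins sets_borel_of_discrete \<Omega>_def Pow_iff\<close>)
      then obtain \<gamma> where \<gamma>: "\<forall>A\<in>Pow \<Omega>. A \<subseteq> C a \<longrightarrow>
          measure \<rho> (A \<times> C a) = \<gamma> * measure (biased_coins n s) A"
        unfolding T sets_borel_of_discrete ..
      have "measure \<rho> (A \<times> C a) = \<gamma> * measure (biased_coins n s) A" if "A \<subseteq> C a" for A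
        using \<gamma> that C_sub by blast
      then show ?thesis
        using C1_sub coin[OF that(2)] by simp
    qed
    have m1: "measure \<pi> (C1 a \<times> C a) = (1/2 + t) * measure \<pi> (C a \<times> C a)"
      using cyl[OF causal(1)] t by simp
    have m2: "measure \<pi> (C a \<times> C1 a) = 1/2 * measure \<pi> (C a \<times> C a)"
      using cyl[OF causal(2)] C_sub C1_sub by (simp add: measure_swap_coupling_Times[OF probs])
    have ev: "A \<times> B \<in> events" if "A \<subseteq> C a" "B \<subseteq> C a" for A B
      using that C_sub by (auto simp: sets_\<pi>)
    \<comment> \<open>Agreement excludes that the next coin is 1 on the left only. By
      \<open>m1\<close> and \<open>m2\<close> this event carries at least the fraction
      \<open>(1/2 + t) - 1/2 = t\<close> of the square.\<close>
    have "D (Suc k) \<inter> C a \<times> C a \<subseteq> C a \<times> C a - (C1 a \<times> C a - C a \<times> C1 a)"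
      by (auto simp: D_def C1_iff)
    then have "measure \<pi> (D (Suc k) \<inter> C a \<times> C a)
        \<le> measure \<pi> (C a \<times> C a - (C1 a \<times> C a - C a \<times> C1 a))"
      using ev C1_sub by (intro finite_measure_mono) auto
    also have "\<dots> = measure \<pi> (C a \<times> C a) - measure \<pi> (C1 a \<times> C a - C a \<times> C1 a)"
      using ev C1_sub by (intro finite_measure_Diff) auto
    finally have "measure \<pi> (D (Suc k) \<inter> C a \<times> C a)
        \<le> measure \<pi> (C a \<times> C a) - measure \<pi> (C1 a \<times> C a - C a \<times> C1 a)" .
    moreover have "measure \<pi> (C1 a \<times> C a) \<le> measure \<pi> ((C1 a \<times> C a - C a \<times> C1 a) \<union> C a \<times> C1 a)"
      using ev C1_sub by (intro finite_measure_mono) auto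
    then have "measure \<pi> (C1 a \<times> C a) \<le> measure \<pi> (C1 a \<times> C a - C a \<times> C1 a) + measure \<pi> (C a \<times> C1 a)"
      using ev C1_sub by (intro order_trans[OF _ measure_subadditive]) auto
    ultimately show ?thesis
      using m1 m2 by (simp add: algebra_simps)
  qed
  \<comment> \<open>The common past of a pair is the restriction of either component to the first
    \<open>k\<close> indices.\<close>
  have D_C: "D k = (\<Union>a\<in>?I. C a \<times> C a)"
  proof (intro equalityI subsetI)
    fix z assume z: "z \<in> D k"
    then have "z \<in> C (restrict (fst z) {1..k}) \<times> C (restrict (fst z) {1..k})"
      by (cases z) (auto simp: D_def C_def \<Omega>_def box_def PiE_iff)
    moreover have "restrict (fst z) {1..k} \<in> ?I"
      using z k by (auto simp: D_def \<Omega>_def PiE_iff)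
    ultimately show "z \<in> (\<Union>a\<in>?I. C a \<times> C a)" by blast
  next
    fix z assume "z \<in> (\<Union>a\<in>?I. C a \<times> C a)"
    then obtain a x y where a: "a \<in> ?I" "z = (x, y)" "x \<in> C a" "y \<in> C a" by blast
    have "C a \<subseteq> \<Omega>"
      unfolding C_def \<Omega>_def using a(1) by (intro PiE_mono) (auto simp: box_def PiE_iff)
    moreover have "x i = a i" "y i = a i" if "i \<in> {1..k}" for i
      using a(3,4) that k by (auto simp: C_def box_def PiE_iff dest!: bspec[of _ _ i])
    ultimately show "z \<in> D k" using a by (auto simp: D_def)
  qed
  have disj: "disjoint_family_on (\<lambda>a. C a \<times> C a) ?I"
    unfolding disjoint_family_on_def
  proof (intro ballI impI)
    fix a b assume ab: "a \<in> ?I" "b \<in> ?I" "a \<noteq> b"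
    then obtain i where "i \<in> {1..k}" "a i \<noteq> b i"
      by (metis PiE_ext)
    then show "C a \<times> C a \<inter> C b \<times> C b = {}"
      using k by (auto simp: C_def box_def PiE_iff dest!: bspec[of _ _ i])
  qed
  have D_sub: "D j \<subseteq> \<Omega> \<times> \<Omega>" for j by (auto simp: D_def)
  have "D (Suc k) \<subseteq> D k" by (auto simp: D_def)
  then have D_Suc: "D (Suc k) = (\<Union>a\<in>?I. D (Suc k) \<inter> C a \<times> C a)"
    using D_C by auto
  have C_ev: "(\<lambda>a. C a \<times> C a) ` ?I \<subseteq> events"
    using D_sub[of k] D_C by (auto simp: sets_\<pi>)
  have "measure \<pi> (D (Suc k)) = (\<Sum>a\<in>?I. measure \<pi> (D (Suc k) \<inter> C a \<times> C a))"
    by (subst D_Suc, rule finite_measure_finite_Union)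
       (use D_sub[of "Suc k"] disj in \<open>auto simp: sets_\<pi> disjoint_family_on_def\<close>)
  also have "\<dots> \<le> (\<Sum>a\<in>?I. (1 - t) * measure \<pi> (C a \<times> C a))"
    by (rule sum_mono) (rule step)
  also have "\<dots> = (1 - t) * measure \<pi> (D k)"
    unfolding D_C sum_distrib_left[symmetric]
    by (subst finite_measure_finite_Union[OF _ C_ev disj]) simp_all
  finally show ?thesis .
qed

text \<open>Iterating the one-step bound gives agreement in all \<open>n\<close> coins with
  probability at most \<open>(1 - t) ^ n\<close>, uniformly over the bicausal couplings.\<close>

lemma ATV_biased_coins_ge:
  assumes t: "0 \<le> t" "t < 1/2"
  shows "2 * (1 - (1 - t) ^ n) \<le> ATV n (\<lambda>_. discrete_topology {0, 1}) (biased_coins n t) (biased_coins n 0)"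
proof -
  let ?X = "\<lambda>_::nat. discrete_topology {0, 1::real}"
  let ?\<Omega> = "{1..n} \<rightarrow>\<^sub>E {0, 1::real}"
  let ?D = "\<lambda>k. {z \<in> ?\<Omega> \<times> ?\<Omega>. \<forall>i\<in>{1..k}. fst z i = snd z i}"
  let ?B = "bicausal_couplings n ?X (biased_coins n t) (biased_coins n 0)"
  have T: "product_space n ?X = discrete_topology ?\<Omega>"
    by (rule product_topology_discrete_topology) simp
  have "sets (borel_of (discrete_topology ?\<Omega>) \<Otimes>\<^sub>M borel_of (discrete_topology ?\<Omega>))
      = sets (count_space ?\<Omega> \<Otimes>\<^sub>M count_space ?\<Omega>)"
    by (rule sets_pair_measure_cong) simp_all
  also have "\<dots> = Pow (?\<Omega> \<times> ?\<Omega>)"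
    by (subst pair_measure_countable) (rule countable_finite[OF finite_cube] sets_count_space)+
  finally have sets_pair: "sets (borel_of (prod_topology (product_space n ?X) (product_space n ?X)))
      = sets (borel_of (product_space n ?X) \<Otimes>\<^sub>M borel_of (product_space n ?X))"
    unfolding T by (simp flip: prod_topology_discrete_topology)
  \<comment> \<open>A lower bound for all elements bounds a real infimum only when the set is
    nonempty.\<close>
  have "biased_coins n t \<Otimes>\<^sub>M biased_coins n 0 \<in> ?B"
    by (rule product_coupling_bicausal[OF _ _ sets_pair]; unfold T; rule biased_coins_borel_probs)
       (use t in simp_all)
  then have "?B \<noteq> {}" by blast
  moreover have "1 - (1 - t) ^ n \<le> (\<integral>z. (if fst z \<noteq> snd z then 1 else 0) \<partial>\<pi>)" if \<pi>: "\<pi> \<in> ?B" for \<pi>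
  proof -
    have "\<pi> \<in> borel_probs (prod_topology (discrete_topology ?\<Omega>) (discrete_topology ?\<Omega>))"
      using \<pi> unfolding bicausal_couplings_def couplings_def T by blast
    then have "prob_space \<pi>" and sets_\<pi>: "sets \<pi> = Pow (?\<Omega> \<times> ?\<Omega>)"
      by (simp_all add: borel_probs_def flip: prod_topology_discrete_topology)
    then interpret prob_space \<pi> by simp
    have sp: "space \<pi> = ?\<Omega> \<times> ?\<Omega>"
      using sets_eq_imp_space_eq[of \<pi> "count_space (?\<Omega> \<times> ?\<Omega>)"] sets_\<pi> by simp
    have "k \<le> n \<Longrightarrow> measure \<pi> (?D k) \<le> (1 - t) ^ k" for k
    proof (induction k)
      case (Suc k)
      then have "measure \<pi> (?D (Suc k)) \<le> (1 - t) * measure \<pi> (?D k)"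
        using bicausal_agreement_step[OF t _ \<pi>, of k] by simp
      also have "\<dots> \<le> (1 - t) * (1 - t) ^ k"
        using Suc t by (intro mult_left_mono) auto
      finally show ?case by simp
    qed simp
    then have "measure \<pi> (?D n) \<le> (1 - t) ^ n" by simp
    \<comment> \<open>Both components are extensional on \<open>{1..n}\<close>, so agreement in all
      \<open>n\<close> coordinates is equality.\<close>
    moreover have "(\<integral>z. (if fst z \<noteq> snd z then 1 else 0 :: real) \<partial>\<pi>) = (\<integral>z. indicator (space \<pi> - ?D n) z \<partial>\<pi>)"
    proof (rule Bochner_Integration.integral_cong[OF refl])
      fix z assume "z \<in> space \<pi>"
      then have "z \<in> ?D n \<longleftrightarrow> fst z = snd z"
        unfolding sp using PiE_ext[of "fst z" "{1..n}" "\<lambda>_. {0, 1}" "snd z"] by auto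
      with \<open>z \<in> space \<pi>\<close> show "(if fst z \<noteq> snd z then 1 else 0) = (indicator (space \<pi> - ?D n) z :: real)"
        by (simp add: indicator_def)
    qed
    moreover have "measure \<pi> (space \<pi> - ?D n) = 1 - measure \<pi> (?D n)"
      by (rule prob_compl) (auto simp: sets_\<pi>)
    ultimately show ?thesis by (simp add: Int_absorb2[OF Diff_subset])
  qed
  ultimately have "1 - (1 - t) ^ n \<le> (INF \<pi>\<in>?B. \<integral>z. (if fst z \<noteq> snd z then 1 else 0) \<partial>\<pi>)"
    by (rule cINF_greatest)
  then show ?thesis unfolding ATV_def by (intro mult_left_mono) simp_all
qed

section \<open>Small bias asymptotics\<close>

theorem corollary2p3:
  fixes n :: nat and c :: real
  assumes "n \<ge> 1" and "c < sqrt (real n)"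
  shows "\<exists>(X :: nat \<Rightarrow> real topology) \<mu> \<nu>.
           (\<forall>i\<in>{1..n}. Polish_space (X i)) \<and>
           \<mu> \<in> borel_probs (product_space n X) \<and>
           \<nu> \<in> borel_probs (product_space n X) \<and>
           0 < rel_entropy \<mu> \<nu> \<and> rel_entropy \<mu> \<nu> < \<infinity> \<and>
           ATV n X \<mu> \<nu> > c * sqrt (2 * real_of_ereal (rel_entropy \<mu> \<nu>))"
proof -
  \<comment> \<open>The entropy of a single coin. Its linear terms cancel, so it is of order
    \<open>t^2\<close>, and its square root is of the same order \<open>t\<close> as the bound for
    \<open>ATV\<close>.\<close>
  define h where "h t = (1/2 + t) * ln (1 + 2*t) + (1/2 - t) * ln (1 - 2*t)" for t :: real
  have h: "((\<lambda>t. h t / t^2) \<longlongrightarrow> 2) (at_right 0)"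
    unfolding h_def by real_asymp
  have tv: "((\<lambda>t::real. (1 - (1 - t) ^ n) / t) \<longlongrightarrow> real n) (at_right 0)"
    by real_asymp
  \<comment> \<open>The desired gap divided by \<open>t\<close>, with the divisor moved under the
    root as \<open>t^2\<close>. Its limit is positive precisely because \<open>c\<close> lies below
    \<open>sqrt n\<close>.\<close>
  have "((\<lambda>t. 2 * ((1 - (1 - t) ^ n) / t) - c * sqrt (2 * (n * (h t / t^2))))
      \<longlongrightarrow> 2 * real n - c * sqrt (2 * (real n * 2))) (at_right 0)"
    by (intro tendsto_intros h tv)
  moreover have "2 * real n - c * sqrt (2 * (real n * 2)) = 2 * sqrt n * (sqrt n - c)"
    by (simp add: real_sqrt_mult algebra_simps)
  then have "0 < 2 * real n - c * sqrt (2 * (real n * 2))"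
    using assms by simp
  ultimately have "\<forall>\<^sub>F t in at_right 0. 0 < 2 * ((1 - (1 - t) ^ n) / t) - c * sqrt (2 * (n * (h t / t^2)))"
    by (rule order_tendstoD(1))
  moreover have "\<forall>\<^sub>F t in at_right 0. 0 < h t / t^2"
    using h by (rule order_tendstoD(1)) simp
  moreover have "\<forall>\<^sub>F t in at_right 0. t \<in> {0<..<1/2::real}"
    by (rule eventually_at_right_real) simp
  ultimately have "\<forall>\<^sub>F t in at_right 0. 0 < t \<and> t < 1/2 \<and> 0 < h t \<and>
      c * sqrt (2 * (n * h t)) < 2 * (1 - (1 - t) ^ n)"
  proof eventually_elim
    case (elim t)
    have "sqrt (2 * (n * (h t / t^2))) = sqrt (2 * (n * h t)) / t"
      using elim(3) unfolding times_divide_eq_right real_sqrt_divide by simp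
    with elim show ?case
      by (simp add: zero_less_divide_iff field_simps)
  qed
  \<comment> \<open>The filter of right neighbourhoods of 0 is nontrivial, so one bias meets all
    conditions at once; \<open>0 < h t\<close> makes the entropy positive.\<close>
  then obtain t where t: "0 < t" "t < 1/2" "0 < h t"
    and less: "c * sqrt (2 * (n * h t)) < 2 * (1 - (1 - t) ^ n)"
    using eventually_happens[of _ "at_right (0::real)"] by (auto simp: trivial_limit_at_right_real)
  let ?X = "\<lambda>_::nat. discrete_topology {0, 1::real}"
  have T: "product_space n ?X = discrete_topology ({1..n} \<rightarrow>\<^sub>E {0, 1})"
    by (rule product_topology_discrete_topology) simp
  have H: "rel_entropy (biased_coins n t) (biased_coins n 0) = ereal (n * h t)"
    using t by (simp add: rel_entropy_biased_coins h_def)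
  show ?thesis
  proof (rule exI[of _ ?X], rule exI[of _ "biased_coins n t"], rule exI[of _ "biased_coins n 0"],
      intro conjI ballI)
    show "Polish_space (?X i)" for i
      by (simp add: Polish_space_def completely_metrizable_space_discrete_topology
          separable_space_discrete_topology countable_finite)
    show "biased_coins n t \<in> borel_probs (product_space n ?X)"
      "biased_coins n 0 \<in> borel_probs (product_space n ?X)"
      unfolding T by (rule biased_coins_borel_probs, use t in simp)+
    show "c * sqrt (2 * real_of_ereal (rel_entropy (biased_coins n t) (biased_coins n 0)))
        < ATV n ?X (biased_coins n t) (biased_coins n 0)"
      using less ATV_biased_coins_ge[of t n] t by (simp add: H)
  qed (use H t assms in simp_all)
qed

end
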